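(* Let $A\in\mathbb C^{n\times n}$ be an oscillatory Hermitian matrix with smallest eigenvalue $\lambda_{\min}$. Then $$\|A^{-1}\|_\infty\le\frac{\|A\|_\infty}{\lambda_{\min}^2}.$$
   Context: A matrix is totally nonnegative (resp. totally positive) if all its minors are nonnegative (resp. positive). A totally nonnegative matrix $A$ is oscillatory if $A^l$ is totally positive for some $l\in\mathbb N$. $\|\cdot\|_\infty$ is the operator norm induced by the max-norm on $\mathbb C^n$ (maximum absolute row sum). *)

theory Defs
  imports "Jordan_Normal_Form.DL_Submatrix" "Jordan_Normal_Form.Determinant"
          "Jordan_Normal_Form.Char_Poly"
begin

text \<open>Complex matrices are Jordan_Normal_Form matrices; row/column indices are 0..<n.
  A minor is det (submatrix A I J) with I, J index sets of equal nonempty cardinality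
  (rows/columns taken in increasing order).\<close>

definition complex_nonneg :: "complex \<Rightarrow> bool" where
  "complex_nonneg z \<longleftrightarrow> Im z = 0 \<and> Re z \<ge> 0"

definition complex_pos :: "complex \<Rightarrow> bool" where
  "complex_pos z \<longleftrightarrow> Im z = 0 \<and> Re z > 0"

definition totally_nonneg :: "complex mat \<Rightarrow> bool" where
  "totally_nonneg A \<longleftrightarrow> (\<forall>I J. I \<subseteq> {0..<dim_row A} \<and> J \<subseteq> {0..<dim_col A}
      \<and> card I = card J \<and> I \<noteq> {} \<longrightarrow> complex_nonneg (det (submatrix A I J)))"

definition totally_pos :: "complex mat \<Rightarrow> bool" where
  "totally_pos A \<longleftrightarrow> (\<forall>I J. I \<subseteq> {0..<dim_row A} \<and> J \<subseteq> {0..<dim_col A}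
      \<and> card I = card J \<and> I \<noteq> {} \<longrightarrow> complex_pos (det (submatrix A I J)))"

definition oscillatory :: "complex mat \<Rightarrow> bool" where
  "oscillatory A \<longleftrightarrow> totally_nonneg A \<and> (\<exists>l::nat. l \<ge> 1 \<and> totally_pos (A ^\<^sub>m l))"

definition hermitian :: "complex mat \<Rightarrow> bool" where
  "hermitian A \<longleftrightarrow> dim_row A = dim_col A \<and>
     (\<forall>i j. i < dim_row A \<and> j < dim_row A \<longrightarrow> A $$ (i, j) = cnj (A $$ (j, i)))"

text \<open>Operator norm induced by the max-norm: maximum absolute row sum.\<close>
definition norm_inf :: "complex mat \<Rightarrow> real" where
  "norm_inf A = Max {(\<Sum>j<dim_col A. cmod (A $$ (i, j))) | i. i < dim_row A}"

definition inv_mat :: "complex mat \<Rightarrow> complex mat" where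
  "inv_mat A = (SOME B. B \<in> carrier_mat (dim_row A) (dim_row A) \<and>
                        A * B = 1\<^sub>m (dim_row A) \<and> B * A = 1\<^sub>m (dim_row A))"

end

theory Submission
  imports Defs "HOL-Analysis.Function_Topology"
begin

text \<open>
  The signs of \<open>A\<inverse>\<close> form a checkerboard, so \<open>|A\<inverse>|\<close> is conjugate to \<open>A\<inverse>\<close> by a diagonal matrix
  of signs. Hence \<open>c = \<lambda>|A\<inverse>|\<close>, with \<open>\<lambda>\<close> the smallest eigenvalue, is nonnegative, symmetric and has
  quadratic form at most \<open>|v|\<^sup>2\<close>; its diagonal is at least \<open>q = \<lambda> / r\<close> for \<open>r\<close> the norm of \<open>A\<close>. Since
  \<open>A\<close> with row and column \<open>j\<close> deleted is totally nonnegative too, the signs of its inverse give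
  \<open>c\<^sub>i\<^sub>k c\<^sub>j\<^sub>j \<le> c\<^sub>i\<^sub>j c\<^sub>j\<^sub>k\<close> for \<open>i < j < k\<close>. Testing the quadratic form of \<open>c\<close> on row \<open>m\<close> of \<open>c\<close>
  (with \<open>c\<^sub>m\<^sub>m\<close> replaced by \<open>1\<close>), weighted by \<open>\<theta>\<close> to the power \<open>|k - m|\<close> with \<open>\<theta> = 1 / (1 - q)\<close>, bounds a geometrically weighted sum of
  the \<open>c\<^sub>m\<^sub>k\<^sup>2\<close>; AM-GM turns this into the bound \<open>1 / q\<close> for the sum of row \<open>m\<close>.
\<close>

section \<open>Minimal Rayleigh quotient of a real symmetric matrix\<close>

text \<open>By compactness the quadratic form attains a minimum on the unit sphere; its first-order
  condition is the eigenvector equation, and homogeneity extends the lower bound to all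
  vectors.\<close>

lemma symmetric_min_eigenvector:
  fixes r :: "nat \<Rightarrow> nat \<Rightarrow> real"
  assumes n: "0 < n" and sym: "\<And>i j. i < n \<Longrightarrow> j < n \<Longrightarrow> r i j = r j i"
  shows "\<exists>\<mu> v. (\<exists>i<n. v i \<noteq> 0) \<and> (\<forall>i<n. (\<Sum>j<n. r i j * v j) = \<mu> * v i)
    \<and> (\<forall>x. \<mu> * (\<Sum>i<n. x i ^ 2) \<le> (\<Sum>i<n. \<Sum>j<n. x i * r i j * x j))"
proof -
  define Q where "Q x = (\<Sum>i<n. \<Sum>j<n. x i * r i j * x j)" for x :: "nat \<Rightarrow> real"
  define N where "N x = (\<Sum>i<n. x i ^ 2)" for x :: "nat \<Rightarrow> real"
  \<comment> \<open>Vectors are functions on all naturals with the product topology. Pinning the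
    coordinates from \<open>n\<close> on to 0 makes \<open>K\<close> compact by Tychonoff, while the
    cube still contains the unit sphere.\<close>
  define K where "K = Pi\<^sub>E UNIV (\<lambda>i. if i < n then {-1..1} else {0::real})"
  define S where "S = K \<inter> {x. N x = 1}"
  have contN: "continuous_on UNIV N" unfolding N_def
    by (intro continuous_intros continuous_on_product_coordinates)
  have contQ: "continuous_on UNIV Q" unfolding Q_def
    by (intro continuous_intros continuous_on_product_coordinates)
  have "compactin (product_topology (\<lambda>i. euclidean) UNIV) K" unfolding K_def compactin_PiE by auto
  then have "compact K" by (simp add: euclidean_product_topology)
  moreover have "closed {x. N x = 1}"
    by (rule closed_Collect_eq[OF contN continuous_on_const])
  ultimately have "compact S" unfolding S_def by (rule compact_Int_closed)
  moreover have "(\<lambda>i. if i = 0 then 1 else 0) \<in> S"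
    using n by (auto simp: S_def K_def N_def power2_eq_square if_distrib cong: if_cong)
  ultimately obtain v where v: "v \<in> S" and vmin: "\<And>y. y \<in> S \<Longrightarrow> Q v \<le> Q y"
    using continuous_attains_inf[OF _ _ continuous_on_subset[OF contQ subset_UNIV], of S] by blast
  define \<mu> where "\<mu> = Q v"
  have Nv: "N v = 1" using v by (simp add: S_def)
  have low: "\<mu> * N x \<le> Q x" for x
  proof (cases "N x = 0")
    case True
    then have "\<forall>i<n. x i = 0" by (auto simp: N_def sum_nonneg_eq_0_iff)
    then show ?thesis using True by (simp add: Q_def)
  next
    case False
    then have pos: "N x > 0" by (metis N_def sum_nonneg zero_le_power2 less_eq_real_def)
    define s where "s = sqrt (N x)"
    have s: "s > 0" "s^2 = N x" using pos by (auto simp: s_def)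
    define y where "y = (\<lambda>i. if i < n then x i / s else 0)"
    have Ny: "N y = 1"
    proof -
      have "N y = (\<Sum>i<n. x i ^ 2 / N x)" unfolding N_def[of y]
        by (rule sum.cong) (auto simp: y_def power_divide s)
      also have "\<dots> = N x / N x" unfolding N_def[of x] by (rule sum_divide_distrib[symmetric])
      finally show ?thesis using pos by simp
    qed
    have "y i ^ 2 \<le> 1" if "i < n" for i
      using member_le_sum[of i "{..<n}" "\<lambda>i. y i ^ 2"] that Ny by (simp add: N_def)
    then have "y \<in> S" using Ny
      by (auto simp: S_def K_def PiE_def extensional_def abs_square_le_1 abs_le_iff)
        (auto simp: y_def)
    from vmin[OF this] have "\<mu> \<le> Q y" by (simp add: \<mu>_def)
    also have "Q y = (\<Sum>i<n. (\<Sum>j<n. x i * r i j * x j) / s^2)" unfolding Q_def sum_divide_distrib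
      by (intro sum.cong) (auto simp: y_def power2_eq_square)
    also have "\<dots> = Q x / N x" by (simp add: Q_def s sum_divide_distrib)
    finally show ?thesis using pos by (simp add: field_simps)
  qed
  define g where "g i = (\<Sum>j<n. r i j * v j) - \<mu> * v i" for i
  \<comment> \<open>The gradient of \<open>Q - \<mu> N\<close> vanishes at its minimum \<open>v\<close>.\<close>
  have "g k = 0" if k: "k < n" for k
  proof -
    have expand: "Q (v(k := v k + t)) - \<mu> * N (v(k := v k + t)) = 2 * t * g k + t^2 * (r k k - \<mu>)" for t
    proof -
      define e where "e i = (if i = k then t else 0)" for i :: nat
      have upd: "v(k := v k + t) = (\<lambda>i. v i + e i)" by (auto simp: e_def)
      have "Q (\<lambda>i. v i + e i) = Q v + (\<Sum>i<n. \<Sum>j<n. v i * r i j * e j)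
          + (\<Sum>i<n. \<Sum>j<n. e i * r i j * v j) + (\<Sum>i<n. \<Sum>j<n. e i * r i j * e j)"
        unfolding Q_def by (simp add: algebra_simps sum.distrib)
      moreover have "(\<Sum>i<n. \<Sum>j<n. v i * r i j * e j) = (\<Sum>i<n. v i * r i k * t)"
        using k by (simp add: e_def if_distrib[where f = "\<lambda>x. _ * x"] cong: if_cong)
      moreover have "(\<Sum>i<n. v i * r i k * t) = t * (\<Sum>j<n. r k j * v j)"
        unfolding sum_distrib_left by (rule sum.cong) (auto simp: sym[OF k])
      moreover have "(\<Sum>i<n. \<Sum>j<n. e i * r i j * v j) = (\<Sum>i<n. if i = k then t * (\<Sum>j<n. r k j * v j) else 0)"
        by (rule sum.cong) (auto simp: e_def sum_distrib_left mult.assoc)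
      moreover have "(\<Sum>i<n. \<Sum>j<n. e i * r i j * e j) = (\<Sum>i<n. if i = k then t * r k k * t else 0)"
        using k by (intro sum.cong) (auto simp: e_def if_distrib[where f = "\<lambda>x. _ * x"] cong: if_cong)
      ultimately have 1: "Q (\<lambda>i. v i + e i) = Q v + 2 * t * (\<Sum>j<n. r k j * v j) + t^2 * r k k"
        using k by (simp add: power2_eq_square)
      have "N (\<lambda>i. v i + e i) = N v + (\<Sum>i<n. 2 * v i * e i) + (\<Sum>i<n. e i ^ 2)"
        unfolding N_def by (simp add: power2_sum sum.distrib algebra_simps)
      moreover have "(\<Sum>i<n. 2 * v i * e i) = (\<Sum>i<n. if i = k then 2 * v k * t else 0)"
        by (rule sum.cong) (auto simp: e_def)
      moreover have "(\<Sum>i<n. e i ^ 2) = (\<Sum>i<n. if i = k then t^2 else 0)"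
        by (rule sum.cong) (auto simp: e_def)
      ultimately have 2: "N (\<lambda>i. v i + e i) = 1 + 2 * v k * t + t^2" using k Nv by simp
      show ?thesis unfolding upd 1 2 by (simp add: \<mu>_def g_def algebra_simps)
    qed
    have nonneg: "0 \<le> 2 * t * g k + t^2 * (r k k - \<mu>)" for t
      using low[of "v(k := v k + t)"] expand[of t] by linarith
    \<comment> \<open>\<open>b\<close> is a positive upper bound of the quadratic coefficient. At
      \<open>t = - g k / b\<close> the nonnegative polynomial is at most
      \<open>- (g k ^ 2 / b)\<close>, which forces \<open>g k = 0\<close>.\<close>
    define b where "b = \<bar>r k k - \<mu>\<bar> + 1"
    have b: "b > 0" "r k k - \<mu> \<le> b" by (auto simp: b_def)
    have "(- g k / b)^2 * (r k k - \<mu>) \<le> (- g k / b)^2 * b" using b by (intro mult_left_mono) auto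
    with nonneg[of "- g k / b"] have "0 \<le> 2 * (- g k / b) * g k + (- g k / b)^2 * b" by linarith
    also have "\<dots> = - (g k ^ 2 / b)" using b by (simp add: power2_eq_square field_simps)
    finally show "g k = 0" using b by (simp add: field_simps)
  qed
  then have "\<And>i. i < n \<Longrightarrow> (\<Sum>j<n. r i j * v j) = \<mu> * v i" by (simp add: g_def)
  moreover have "\<exists>i<n. v i \<noteq> 0" using Nv unfolding N_def
    by (metis (no_types, lifting) lessThan_iff sum.neutral zero_neq_one zero_power2)
  ultimately show ?thesis using low unfolding Q_def N_def by blast
qed

section \<open>Row sums of a nonnegative symmetric matrix with form at most the identity\<close>

text \<open>The hypothesis on \<theta> gives
  \<open>q * \<theta> ^ Suc d = \<theta> ^ Suc d - \<theta> ^ d\<close>, so the sum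
  telescopes.\<close>

lemma geometric_right:
  fixes \<theta> q :: real
  assumes "q * \<theta> = \<theta> - 1" "(m::nat) < k"
  shows "1 + q * (\<Sum>j\<in>{m<..<k}. \<theta> ^ (j - m)) = \<theta> ^ (k - m - 1)"
  using \<open>m < k\<close>
proof (induction k)
  case (Suc k)
  show ?case
  proof (cases "m = k")
    case False
    then have mk: "m < k" using Suc by simp
    then have "{m<..<Suc k} = insert k {m<..<k}" by auto
    then have "1 + q * (\<Sum>j\<in>{m<..<Suc k}. \<theta> ^ (j - m)) = \<theta> ^ (k - m - 1) + q * \<theta> ^ (k - m)"
      using Suc.IH[OF mk] by (simp add: algebra_simps)
    also have "\<theta> ^ (k - m) = \<theta> * \<theta> ^ (k - m - 1)" using mk by (metis Suc_diff_1 power_Suc zero_less_diff)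
    also have "\<theta> ^ (k - m - 1) + q * (\<theta> * \<theta> ^ (k - m - 1)) = \<theta> ^ (k - m - 1) * (1 + q * \<theta>)"
      by (simp add: algebra_simps)
    also have "\<dots> = \<theta> * \<theta> ^ (k - m - 1)" using assms(1) by simp
    also have "\<dots> = \<theta> ^ (Suc k - m - 1)" using mk
      by (metis Suc_diff_1 diff_Suc_1 Suc_diff_le less_imp_le power_Suc zero_less_diff)
    finally show ?thesis .
  next
    case True then have "{m<..<Suc k} = {}" by auto
    then show ?thesis using True by simp
  qed
qed simp

lemma geometric_left:
  fixes \<theta> q :: real
  assumes "q * \<theta> = \<theta> - 1" "(k::nat) < m"
  shows "1 + q * (\<Sum>j\<in>{k<..<m}. \<theta> ^ (m - j)) = \<theta> ^ (m - k - 1)"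
proof -
  have "(\<Sum>j\<in>{k<..<m}. \<theta> ^ (m - j)) = (\<Sum>j\<in>{0<..<m-k}. \<theta> ^ (j - 0))"
    by (rule sum.reindex_bij_witness[of _ "\<lambda>j. m - j" "\<lambda>j. m - j"]) auto
  then show ?thesis using geometric_right[OF assms(1), of 0 "m - k"] assms(2) by simp
qed

lemma sum_geometric_distance_le:
  fixes x :: real
  assumes "0 \<le> x" "x < 1" "m < n"
  shows "(\<Sum>k\<in>{..<n}-{m}. x ^ ((k - m) + (m - k))) \<le> 2 * x / (1 - x)"
proof -
  have geo: "(\<Sum>d<N. x ^ Suc d) \<le> x / (1 - x)" for N
  proof -
    have "(\<Sum>d<N. x ^ Suc d) \<le> (\<Sum>d. x ^ Suc d)"
      using assms by (intro sum_le_suminf) (auto simp: summable_geometric summable_Suc_iff)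
    also have "\<dots> = x * (1 / (1 - x))" using assms
      by (simp add: suminf_mult summable_geometric suminf_geometric)
    finally show ?thesis by simp
  qed
  have split: "{..<n}-{m} = {..<m} \<union> {m<..<n}" using assms by auto
  have "(\<Sum>k\<in>{..<n}-{m}. x ^ ((k - m) + (m - k)))
      = (\<Sum>k<m. x ^ ((k - m) + (m - k))) + (\<Sum>k\<in>{m<..<n}. x ^ ((k - m) + (m - k)))"
    unfolding split by (rule sum.union_disjoint) auto
  also have "(\<Sum>k<m. x ^ ((k - m) + (m - k))) = (\<Sum>d<m. x ^ Suc d)"
    by (rule sum.reindex_bij_witness[of _ "\<lambda>d. m - Suc d" "\<lambda>k. m - Suc k"])
      (auto simp: Suc_diff_Suc simp del: power_Suc)
  also have "(\<Sum>k\<in>{m<..<n}. x ^ ((k - m) + (m - k))) = (\<Sum>d<n - Suc m. x ^ Suc d)"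
    by (rule sum.reindex_bij_witness[of _ "\<lambda>d. Suc m + d" "\<lambda>k. k - Suc m"])
      (auto simp: Suc_diff_Suc simp del: power_Suc)
  finally show ?thesis using geo[of m] geo[of "n - Suc m"] by simp
qed

text \<open>For \<open>j\<close> between \<open>m\<close> and \<open>k\<close>, \<open>minor\<close>
  and \<open>diag\<close> give \<open>q * c m k \<le> c m j * c j k\<close>. Hence in the form at
  \<open>v\<close> the terms indexed by such \<open>j\<close> all yield multiples of
  \<open>c m k ^ 2\<close>, and the weights make their total exceed \<open>v k ^ 2\<close> by a
  fixed share.\<close>

lemma row_sum_le_inverse:
  fixes c :: "nat \<Rightarrow> nat \<Rightarrow> real" and q :: real
  assumes m: "m < n" and q: "0 < q" "q < 1"
    and nonneg: "\<And>i j. i < n \<Longrightarrow> j < n \<Longrightarrow> 0 \<le> c i j"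
    and sym: "\<And>i j. i < n \<Longrightarrow> j < n \<Longrightarrow> c i j = c j i"
    and diag: "\<And>j. j < n \<Longrightarrow> q \<le> c j j"
    and form: "\<And>v. (\<Sum>i<n. \<Sum>j<n. v i * c i j * v j) \<le> (\<Sum>i<n. v i ^ 2)"
    and minor: "\<And>i j k. i < j \<Longrightarrow> j < k \<Longrightarrow> k < n \<Longrightarrow> c i k * c j j \<le> c i j * c j k"
  shows "(\<Sum>k<n. c m k) \<le> 1 / q"
proof -
  define x where "x = 1 - q"
  have x: "0 < x" "x < 1" using q by (auto simp: x_def)
  \<comment> \<open>This ratio satisfies \<open>q * \<theta> = \<theta> - 1\<close>, the condition
    under which the weights between \<open>m\<close> and \<open>k\<close> telescope.\<close>
  define \<theta> where "\<theta> = 1 / x"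
  have \<theta>: "\<theta> > 0" "q * \<theta> = \<theta> - 1" using x by (auto simp: \<theta>_def x_def field_simps)
  \<comment> \<open>Subtraction truncates, so one summand is 0 and the sum is the distance of
    \<open>k\<close> from \<open>m\<close>.\<close>
  define dist where "dist k = (k - m) + (m - k)" for k
  define w where "w k = \<theta> ^ dist k" for k
  have w: "w k > 0" for k using \<theta> by (simp add: w_def)
  \<comment> \<open>With the value 1 at \<open>m\<close>, the term \<open>v m * c m k * v k\<close>
    equals \<open>w k * c m k ^ 2\<close>, free of the factor \<open>c m m\<close>.\<close>
  define v where "v k = (if k = m then 1 else w k * c m k)" for k
  define R where "R j k \<longleftrightarrow> (m \<le> j \<and> j < k) \<or> (k < j \<and> j \<le> m)" for j k
  define h where "h j k = (if j = m then w k * c m k ^ 2 else q * w j * w k * c m k ^ 2)" for j k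
  define g where "g k = (if k = m then c m m else q * w k ^ 2 * c m k ^ 2)" for k
  \<comment> \<open>\<open>v j * c j k * v k\<close> is bounded below by \<open>h j k\<close> if \<open>j\<close> lies between \<open>m\<close> and \<open>k\<close>, and by \<open>0\<close> if
    \<open>j\<close> and \<open>k\<close> lie on different sides of \<open>m\<close>.\<close>
  have hle: "h j k \<le> v j * c j k * v k" if R: "R j k" and jk: "j < n" "k < n" for j k
  proof (cases "j = m")
    case True
    then show ?thesis using R by (auto simp: R_def h_def v_def power2_eq_square)
  next
    case False
    have "c m k * c j j \<le> c m j * c j k"
      using R False jk minor[of m j k] minor[of k j m] m
      by (auto simp: R_def sym[of k j] sym[of k m] sym[of j m] mult.commute)
    moreover have "c m k * q \<le> c m k * c j j" using diag nonneg m jk by (intro mult_left_mono) auto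
    ultimately have "c m k * q \<le> c m j * c j k" by linarith
    then have "(w j * w k * c m k) * (c m k * q) \<le> (w j * w k * c m k) * (c m j * c j k)"
      using w[of j] w[of k] nonneg[OF m jk(2)] by (intro mult_left_mono) auto
    then show ?thesis using False R by (auto simp: R_def h_def v_def power2_eq_square mult_ac)
  qed
  have gle: "g k \<le> v k * c k k * v k" if "k < n" for k
  proof (cases "k = m")
    case False
    have "(w k * c m k)^2 * q \<le> (w k * c m k)^2 * c k k"
      using diag[OF that] by (intro mult_left_mono) auto
    then show ?thesis using False by (simp add: g_def v_def power2_eq_square mult_ac)
  qed (simp add: g_def v_def)
  have pos: "0 \<le> v j * c j k * v k" if "j < n" "k < n" for j k
    using that m by (auto simp: v_def intro!: mult_nonneg_nonneg nonneg less_imp_le[OF w])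
  \<comment> \<open>At most one of the three summands is nonzero. By symmetry each
    \<open>h j k\<close> is counted at both \<open>(j, k)\<close> and \<open>(k, j)\<close>, whence
    the factor 2 in front of \<open>H k\<close> below.\<close>
  have low: "(if j = k then g k else 0) + (if R j k then h j k else 0) + (if R k j then h k j else 0)
      \<le> v j * c j k * v k" if jk: "j < n" "k < n" for j k
    using gle[OF jk(2)] hle[of j k] hle[of k j] pos[OF jk] jk sym[OF jk]
    by (auto simp: R_def mult_ac)
  define H where "H k = (\<Sum>j<n. if R j k then h j k else 0)" for k
  have "(\<Sum>j<n. \<Sum>k<n. (if j = k then g k else 0) + (if R j k then h j k else 0) + (if R k j then h k j else 0))
      \<le> (\<Sum>j<n. \<Sum>k<n. v j * c j k * v k)"
    by (intro sum_mono low) auto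
  also have "\<dots> \<le> (\<Sum>k<n. v k ^ 2)" by (rule form)
  finally have "(\<Sum>j<n. \<Sum>k<n. if j = k then g k else 0) + (\<Sum>j<n. \<Sum>k<n. if R j k then h j k else 0)
      + (\<Sum>j<n. H j) \<le> (\<Sum>k<n. v k ^ 2)"
    by (simp add: sum.distrib H_def)
  moreover have "(\<Sum>j<n. \<Sum>k<n. if R j k then h j k else 0) = (\<Sum>k<n. H k)"
    unfolding H_def by (rule sum.swap)
  ultimately have "(\<Sum>k<n. g k + 2 * H k) \<le> (\<Sum>k<n. v k ^ 2)"
    by (simp add: sum.distrib flip: sum_distrib_left)
  moreover have Hm: "H m = 0" by (auto simp: H_def R_def intro!: sum.neutral)
  ultimately have "c m m + (\<Sum>k\<in>{..<n}-{m}. g k + 2 * H k) \<le> 1 + (\<Sum>k\<in>{..<n}-{m}. v k ^ 2)"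
    using m by (simp add: sum.remove[of "{..<n}" m] g_def v_def)
  then have *: "(\<Sum>k\<in>{..<n}-{m}. g k + 2 * H k - v k ^ 2) \<le> 1 - c m m"
    by (simp add: sum_subtractf)
  \<comment> \<open>The indices that contribute are \<open>m\<close> and those strictly between
    \<open>m\<close> and \<open>k\<close>; their weights telescope to
    \<open>\<theta> ^ (dist k - 1)\<close>, one power short of \<open>w k\<close>, which produces
    the factor \<open>x\<close>.\<close>
  have H: "H k = x * w k ^ 2 * c m k ^ 2" if k: "k < n" "k \<noteq> m" for k
  proof -
    define J where "J = {m<..<k} \<union> {k<..<m}"
    have set: "{j \<in> {..<n}. R j k} = insert m J" using k m by (auto simp: J_def R_def)
    have "m \<notin> J" "finite J" by (auto simp: J_def)
    have "H k = (\<Sum>j\<in>insert m J. h j k)" unfolding H_def set[symmetric]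
      by (rule sum.inter_filter[symmetric]) simp
    also have "\<dots> = h m k + (\<Sum>j\<in>J. h j k)" using \<open>m \<notin> J\<close> \<open>finite J\<close> by simp
    also have "(\<Sum>j\<in>J. h j k) = (\<Sum>j\<in>J. w k * c m k ^ 2 * (q * w j))"
      using \<open>m \<notin> J\<close> by (intro sum.cong) (auto simp: h_def)
    also have "h m k + \<dots> = w k * c m k ^ 2 * (1 + q * (\<Sum>j\<in>J. w j))"
      by (simp add: h_def distrib_left flip: sum_distrib_left)
    also have "1 + q * (\<Sum>j\<in>J. w j) = \<theta> ^ (dist k - 1)"
    proof (cases "m < k")
      case True
      then have "(\<Sum>j\<in>J. w j) = (\<Sum>j\<in>{m<..<k}. \<theta> ^ (j - m))"
        by (intro sum.cong) (auto simp: J_def w_def dist_def)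
      then show ?thesis using geometric_right[OF \<theta>(2) True] True by (simp add: dist_def)
    next
      case False
      then have "k < m" using k by simp
      then have "(\<Sum>j\<in>J. w j) = (\<Sum>j\<in>{k<..<m}. \<theta> ^ (m - j))"
        by (intro sum.cong) (auto simp: J_def w_def dist_def)
      then show ?thesis using geometric_left[OF \<theta>(2) \<open>k < m\<close>] \<open>k < m\<close> by (simp add: dist_def)
    qed
    also have "\<theta> ^ (dist k - 1) = x * w k"
    proof -
      have "dist k = Suc (dist k - 1)" using k by (auto simp: dist_def)
      then have "w k = \<theta> * \<theta> ^ (dist k - 1)" unfolding w_def by (metis power_Suc)
      then show ?thesis using x by (simp add: \<theta>_def)
    qed
    finally show ?thesis by (simp add: power2_eq_square mult_ac)
  qed
  \<comment> \<open>The coefficient is \<open>q + 2 * x - 1\<close>, which is \<open>x\<close>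
    because \<open>q = 1 - x\<close>.\<close>
  have "g k + 2 * H k - v k ^ 2 = x * w k ^ 2 * c m k ^ 2" if "k \<in> {..<n}-{m}" for k
    using that H[of k] by (simp add: g_def v_def x_def algebra_simps)
  with * have **: "(\<Sum>k\<in>{..<n}-{m}. x * w k ^ 2 * c m k ^ 2) \<le> 1 - c m m" by simp
  have amgm: "c m k \<le> x * w k ^ 2 * c m k ^ 2 + x ^ dist k / 4" if "k \<in> {..<n}-{m}" for k
  proof -
    define V where "V = x * w k ^ 2"
    have V: "V > 0" using x w[of k] by (simp add: V_def)
    have "0 \<le> (2 * V * c m k - 1)^2 / (4 * V)" using V by simp
    also have "\<dots> = V * c m k ^ 2 - c m k + 1 / (4 * V)"
      using V by (simp add: power2_eq_square field_simps)
    finally have 1: "c m k \<le> V * c m k ^ 2 + 1 / (4 * V)" by simp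
    have "dist k \<noteq> 0" using that by (auto simp: dist_def)
    then obtain d where d: "dist k = Suc d" using not0_implies_Suc by blast
    \<comment> \<open>Since \<open>w k\<close> is the inverse of \<open>x ^ dist k\<close>, the
      number \<open>1 / V\<close> is \<open>x\<close> to the power \<open>2 * dist k - 1\<close>;
      this exponent is at least \<open>dist k\<close> because \<open>k\<close> differs from
      \<open>m\<close>.\<close>
    have "1 / V = x ^ Suc d * x ^ d"
      using x by (simp add: V_def w_def d \<theta>_def power_divide power2_eq_square)
    also have "\<dots> \<le> x ^ Suc d * 1" using x by (intro mult_left_mono) (auto simp: power_le_one)
    finally have "1 / V \<le> x ^ dist k" by (simp add: d)
    moreover have "1 / (4 * V) = 1 / V / 4" by simp
    ultimately have "c m k \<le> V * c m k ^ 2 + x ^ dist k / 4" using 1 by linarith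
    then show ?thesis by (simp add: V_def)
  qed
  have "(\<Sum>k<n. c m k) = c m m + (\<Sum>k\<in>{..<n}-{m}. c m k)" using m by (simp add: sum.remove)
  also have "\<dots> \<le> c m m + (\<Sum>k\<in>{..<n}-{m}. x * w k ^ 2 * c m k ^ 2 + x ^ dist k / 4)"
    by (intro add_left_mono sum_mono amgm)
  also have "\<dots> \<le> 1 + (\<Sum>k\<in>{..<n}-{m}. x ^ dist k) / 4"
    using ** by (simp add: sum.distrib sum_divide_distrib)
  \<comment> \<open>As \<open>1 - x = q\<close>, this bound is \<open>1 + x / (2 * q)\<close>,
    whereas \<open>1 / q = 1 + x / q\<close>.\<close>
  also have "\<dots> \<le> 1 + (2 * x / (1 - x)) / 4"
    by (intro add_left_mono divide_right_mono)
      (use sum_geometric_distance_le[OF less_imp_le[OF x(1)] x(2) m] in \<open>simp_all add: dist_def\<close>)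
  also have "\<dots> \<le> 1 / q" using q by (simp add: x_def field_simps)
  finally show ?thesis .
qed

section \<open>Total nonnegativity over the reals and deletion of a row and a column\<close>

text \<open>The empty minor is included: it is harmless, since its determinant is \<open>1\<close>.\<close>
definition tn_real :: "real mat \<Rightarrow> bool" where
  "tn_real R \<longleftrightarrow> (\<forall>I J. I \<subseteq> {0..<dim_row R} \<and> J \<subseteq> {0..<dim_col R} \<and> card I = card J
      \<longrightarrow> 0 \<le> det (submatrix R I J))"

text \<open>An element of a set is determined by the number of smaller elements in it, and an
  increasing map preserves that number.\<close>

lemma pick_image_strict_mono:
  assumes f: "strict_mono f" and i: "i < card S"
  shows "pick (f ` S) i = f (pick S i)"
proof -
  have fin: "finite S" using i card.infinite by fastforce
  have p: "pick S i \<in> S" "card {a \<in> S. a < pick S i} = i"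
    using pick_in_set card_pick i by blast+
  have "{b \<in> f ` S. b < f (pick S i)} = f ` {a \<in> S. a < pick S i}"
    using strict_mono_less[OF f] by auto
  then have "card {b \<in> f ` S. b < f (pick S i)} = i"
    using p(2) strict_mono_imp_inj_on[OF f] by (simp add: card_image inj_on_subset[OF _ subset_UNIV])
  moreover have "f (pick S i) \<in> f ` S" using p by simp
  ultimately show ?thesis using pick_card_in_set by metis
qed

lemma strict_mono_insert_index: "strict_mono (insert_index i)"
  by (auto simp: strict_mono_def insert_index_def)

lemma insert_index_bound: "a < n - 1 \<Longrightarrow> insert_index i a < n"
  by (auto simp: insert_index_def)

lemma mat_delete_entry:
  "a < dim_row A - 1 \<Longrightarrow> b < dim_col A - 1 \<Longrightarrow>
    mat_delete A i j $$ (a, b) = A $$ (insert_index i a, insert_index j b)"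
  by (auto simp: mat_delete_def insert_index_def)

text \<open>Minors after a deletion are minors of the original matrix: \<open>insert_index\<close>
  renumbers the surviving rows and columns in increasing order. Total nonnegativity is therefore
  inherited.\<close>

lemma submatrix_mat_delete:
  assumes I: "I \<subseteq> {0..<dim_row A - 1}" and J: "J \<subseteq> {0..<dim_col A - 1}"
  shows "submatrix (mat_delete A i j) I J = submatrix A (insert_index i ` I) (insert_index j ` J)"
proof -
  have card: "card {a. a < N - 1 \<and> a \<in> K} = card K" "card {a. a < N \<and> a \<in> insert_index l ` K} = card K"
    if "K \<subseteq> {0..<N - 1}" for N K l
  proof -
    have "a < N - 1" "insert_index l a < N" if "a \<in> K" for a
      using that \<open>K \<subseteq> {0..<N - 1}\<close> insert_index_bound[of a N l] by auto
    then have "{a. a < N - 1 \<and> a \<in> K} = K" "{a. a < N \<and> a \<in> insert_index l ` K} = insert_index l ` K"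
      by blast+
    then show "card {a. a < N - 1 \<and> a \<in> K} = card K" "card {a. a < N \<and> a \<in> insert_index l ` K} = card K"
      using strict_mono_imp_inj_on[OF strict_mono_insert_index]
      by (simp_all add: card_image inj_on_subset[OF _ subset_UNIV])
  qed
  have pick: "pick K a < N - 1" if "K \<subseteq> {0..<N - 1}" "a < card K" for N K a
    using that pick_in_set[of a K] by auto
  show ?thesis
  proof (rule eq_matI)
    fix a b assume "a < dim_row (submatrix A (insert_index i ` I) (insert_index j ` J))"
      "b < dim_col (submatrix A (insert_index i ` I) (insert_index j ` J))"
    then have ab: "a < card I" "b < card J" by (simp_all add: dim_submatrix card(2)[OF I] card(2)[OF J])
    then show "submatrix (mat_delete A i j) I J $$ (a, b)
        = submatrix A (insert_index i ` I) (insert_index j ` J) $$ (a, b)"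
      using pick[OF I ab(1)] pick[OF J ab(2)]
      by (simp add: submatrix_def card[OF I, unfolded One_nat_def] card[OF J, unfolded One_nat_def] mat_delete_entry
          pick_image_strict_mono[OF strict_mono_insert_index])
  qed (simp_all add: dim_submatrix card[OF I, unfolded One_nat_def] card[OF J, unfolded One_nat_def])
qed

lemma tn_real_mat_delete:
  assumes "tn_real R"
  shows "tn_real (mat_delete R i j)"
  unfolding tn_real_def
proof (intro allI impI, elim conjE)
  fix I J assume I: "I \<subseteq> {0..<dim_row (mat_delete R i j)}" and J: "J \<subseteq> {0..<dim_col (mat_delete R i j)}"
    and c: "card I = card J"
  have "insert_index i a < dim_row R" if "a \<in> I" for a
    using that I by (intro insert_index_bound) auto
  moreover have "insert_index j b < dim_col R" if "b \<in> J" for b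
    using that J by (intro insert_index_bound) auto
  ultimately have "insert_index i ` I \<subseteq> {0..<dim_row R}" "insert_index j ` J \<subseteq> {0..<dim_col R}"
    by auto
  moreover have "card (insert_index i ` I) = card (insert_index j ` J)"
    using c strict_mono_imp_inj_on[OF strict_mono_insert_index]
    by (simp add: card_image inj_on_subset[OF _ subset_UNIV])
  ultimately have "0 \<le> det (submatrix R (insert_index i ` I) (insert_index j ` J))"
    using assms unfolding tn_real_def by blast
  then show "0 \<le> det (submatrix (mat_delete R i j) I J)"
    using submatrix_mat_delete[of I R J i j] I J by simp
qed

lemma pick_initial_segment: "i < n \<Longrightarrow> pick {0..<n} i = i"
  using pick_card_in_set[of i "{0..<n}"]
  by (simp add: Collect_conj_eq[symmetric] conj_commute cong: conj_cong)

lemma submatrix_full: "submatrix A {0..<dim_row A} {0..<dim_col A} = A"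
  by (rule eq_matI) (auto simp: submatrix_def pick_initial_segment)

lemma tn_real_det: "R \<in> carrier_mat n n \<Longrightarrow> tn_real R \<Longrightarrow> 0 \<le> det R"
  unfolding tn_real_def using submatrix_full[of R]
  by (metis carrier_matD order_refl)

section \<open>Diagonal increments and inverses of totally nonnegative matrices\<close>

text \<open>The determinant is affine in each diagonal entry, with the complementary principal minor
  as slope. The entries are raised one at a time. The raised matrix need not be totally nonnegative,
  so the sign of the slope comes from induction on the dimension.\<close>

lemma det_add_diag_ge:
  assumes "R \<in> carrier_mat n n" "tn_real R" "\<And>i. i < n \<Longrightarrow> 0 \<le> d i"
  shows "det R \<le> det (mat n n (\<lambda>(i, j). R $$ (i, j) + (if i = j then d i else 0)))"
  using assms
proof (induction n arbitrary: R d)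
  case 0
  then show ?case by simp
next
  case (Suc n)
  note R = Suc.prems(1) and tn = Suc.prems(2) and d_nonneg = Suc.prems(3) and IH = Suc.IH
  define M where "M k = mat (Suc n) (Suc n) (\<lambda>(i, j). R $$ (i, j) + (if i = j \<and> i < k then d i else 0))" for k
  have M: "M k \<in> carrier_mat (Suc n) (Suc n)" for k by (simp add: M_def)
  have "det R \<le> det (M k)" if "k \<le> Suc n" for k
    using that
  proof (induction k)
    case 0
    have "M 0 = R" using R by (intro eq_matI) (auto simp: M_def)
    then show ?case by simp
  next
    case (Suc k)
    then have k: "k < Suc n" by simp
    have del: "mat_delete (M (Suc k)) k j = mat_delete (M k) k j" for j
      by (rule eq_matI) (auto simp: M_def mat_delete_def)
    have ent: "M (Suc k) $$ (k, j) = M k $$ (k, j) + (if j = k then d k else 0)" if "j < Suc n" for j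
      using that k by (simp add: M_def)
    have "det (M (Suc k)) = (\<Sum>j<Suc n. M (Suc k) $$ (k, j) * cofactor (M (Suc k)) k j)"
      by (rule laplace_expansion_row[OF M k])
    also have "\<dots> = (\<Sum>j<Suc n. M k $$ (k, j) * cofactor (M k) k j + (if j = k then d k * det (mat_delete (M k) k k) else 0))"
    proof (rule sum.cong)
      fix j assume "j \<in> {..<Suc n}"
      then show "M (Suc k) $$ (k, j) * cofactor (M (Suc k)) k j
          = M k $$ (k, j) * cofactor (M k) k j + (if j = k then d k * det (mat_delete (M k) k k) else 0)"
        using ent[of j] by (simp add: cofactor_def del distrib_right)
    qed simp
    also have "\<dots> = det (M k) + d k * det (mat_delete (M k) k k)"
      using k laplace_expansion_row[OF M k, of k] by (simp add: sum.distrib del: sum.lessThan_Suc)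
    finally have det: "det (M (Suc k)) = det (M k) + d k * det (mat_delete (M k) k k)" .
    \<comment> \<open>These are the increments already made, renumbered after the deletion of row
      and column \<open>k\<close>.\<close>
    define d' where "d' i = (if insert_index k i < k then d (insert_index k i) else 0)" for i
    have d': "0 \<le> d' i" if "i < n" for i
      using k by (simp add: d'_def d_nonneg)
    have md: "mat_delete R k k \<in> carrier_mat n n" using R mat_delete_carrier[of R "Suc n" "Suc n"] by simp
    have "mat_delete (M k) k k = mat n n (\<lambda>(i, j). mat_delete R k k $$ (i, j) + (if i = j then d' i else 0))"
      using R by (intro eq_matI) (auto simp: M_def mat_delete_def d'_def insert_index_def)
    then have "det (mat_delete R k k) \<le> det (mat_delete (M k) k k)"
      using IH[OF md tn_real_mat_delete[OF tn] d'] by simp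
    then have "0 \<le> det (mat_delete (M k) k k)"
      using tn_real_det[OF md tn_real_mat_delete[OF tn]] by linarith
    then have "0 \<le> d k * det (mat_delete (M k) k k)" using d_nonneg[OF k] by simp
    then show ?case using Suc det by simp
  qed
  moreover have "M (Suc n) = mat (Suc n) (Suc n) (\<lambda>(i, j). R $$ (i, j) + (if i = j then d i else 0))"
    by (rule eq_matI) (auto simp: M_def)
  ultimately show ?case by (metis order_refl)
qed

text \<open>By the adjugate formula an entry of the inverse is a signed minor of \<open>R\<close>
  divided by the positive determinant.\<close>

lemma tn_real_inverse_checkerboard:
  assumes R: "R \<in> carrier_mat n n" and tn: "tn_real R"
    and S: "S \<in> carrier_mat n n" and RS: "R * S = 1\<^sub>m n" and ij: "i < n" "j < n"
  shows "0 \<le> (-1) ^ (i + j) * S $$ (i, j)"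
proof -
  have "det R * det S = 1" using det_mult[OF R S] RS by simp
  then have det: "det R > 0" using tn_real_det[OF R tn] by (metis less_eq_real_def mult_zero_left zero_neq_one)
  have "adj_mat R = adj_mat R * (R * S)" using RS adj_mat(1)[OF R] by simp
  also have "\<dots> = det R \<cdot>\<^sub>m S" using adj_mat[OF R] R S
    by (simp add: mult_smult_assoc_mat[of _ n n _ n] flip: assoc_mult_mat[of _ n n _ n _ n])
  finally have "adj_mat R $$ (i, j) = (det R \<cdot>\<^sub>m S) $$ (i, j)" by simp
  then have "det R * S $$ (i, j) = (-1) ^ (j + i) * det (mat_delete R j i)"
    using R S ij by (simp add: adj_mat_def cofactor_def)
  moreover have "(-1) ^ (i + j) * S $$ (i, j) * det R = (-1) ^ (i + j) * (det R * S $$ (i, j))"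
    by (simp only: mult_ac)
  ultimately have "(-1) ^ (i + j) * S $$ (i, j) * det R = ((-1) ^ (i + j) * (-1) ^ (i + j)) * det (mat_delete R j i)"
    by (simp only: mult.assoc add.commute[of j i])
  also have "\<dots> = det (mat_delete R j i)" by (simp flip: power_add)
  also have "\<dots> \<ge> 0"
    using tn_real_det[OF mat_delete_carrier[OF R] tn_real_mat_delete[OF tn]] .
  finally show ?thesis using det by (simp add: zero_le_mult_iff)
qed

text \<open>The inverse of \<open>R\<close> without row and column \<open>j\<close> is the Schur
  complement of \<open>S $$ (j, j)\<close> in \<open>S\<close>, and its signs form a checkerboard
  too. Deletion moves \<open>k\<close> to \<open>k - 1\<close> but fixes \<open>i\<close>, so the
  sign at \<open>(i, k)\<close> is opposite to that in \<open>S\<close>.\<close>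

lemma tn_real_inverse_minor:
  assumes R: "R \<in> carrier_mat n n" and tn: "tn_real R"
    and S: "S \<in> carrier_mat n n" and RS: "R * S = 1\<^sub>m n"
    and ijk: "i < j" "j < k" "k < n" and pos: "0 < S $$ (j, j)"
  shows "((-1) ^ (i + k) * S $$ (i, k)) * S $$ (j, j)
    \<le> ((-1) ^ (i + j) * S $$ (i, j)) * ((-1) ^ (j + k) * S $$ (j, k))"
proof -
  define G where "G a b = S $$ (a, b) - S $$ (a, j) * S $$ (j, b) / S $$ (j, j)" for a b
  define G' where "G' = mat (n - 1) (n - 1) (\<lambda>(a, b). G (insert_index j a) (insert_index j b))"
  have R': "mat_delete R j j \<in> carrier_mat (n - 1) (n - 1)" by (rule mat_delete_carrier[OF R])
  have G': "G' \<in> carrier_mat (n - 1) (n - 1)" by (simp add: G'_def)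
  have RSe: "(\<Sum>l<n. R $$ (a, l) * S $$ (l, b)) = (if a = b then 1 else 0)" if "a < n" "b < n" for a b
  proof -
    have "(R * S) $$ (a, b) = (\<Sum>l<n. R $$ (a, l) * S $$ (l, b))"
      using R S that by (simp add: scalar_prod_def atLeast0LessThan)
    then show ?thesis using RS that by simp
  qed
  have inv: "mat_delete R j j * G' = 1\<^sub>m (n - 1)"
  proof (rule eq_matI)
    fix a b assume "a < dim_row (1\<^sub>m (n - 1))" "b < dim_col (1\<^sub>m (n - 1))"
    then have ab: "a < n - 1" "b < n - 1" by auto
    let ?a = "insert_index j a" and ?b = "insert_index j b"
    have ab': "?a < n" "?b < n" "?a \<noteq> j" using ab insert_index_bound by auto
    \<comment> \<open>Row \<open>j\<close> of \<open>G\<close> vanishes, so the sum over the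
      surviving indices may be extended to all indices, where \<open>R * S\<close> is known.\<close>
    have Gj: "G j ?b = 0" using pos by (simp add: G_def)
    have "(mat_delete R j j * G') $$ (a, b) = (\<Sum>l = 0..<n - 1. R $$ (?a, insert_index j l) * G (insert_index j l) ?b)"
      using R ab by (simp add: scalar_prod_def G'_def mat_delete_entry)
    also have "\<dots> = (\<Sum>l\<in>insert_index j ` {0..<n - 1}. R $$ (?a, l) * G l ?b)"
      by (subst sum.reindex) (auto intro: inj_on_subset[OF strict_mono_imp_inj_on[OF strict_mono_insert_index]])
    also have "insert_index j ` {0..<n - 1} = {..<n} - {j}"
      using insert_index_image[of j "n - 1"] ijk by (simp add: atLeast0LessThan)
    also have "(\<Sum>l\<in>{..<n} - {j}. R $$ (?a, l) * G l ?b) = (\<Sum>l<n. R $$ (?a, l) * G l ?b)"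
      using ijk by (simp add: sum.remove[of "{..<n}" j] Gj)
    also have "\<dots> = (\<Sum>l<n. R $$ (?a, l) * S $$ (l, ?b)) - (\<Sum>l<n. R $$ (?a, l) * S $$ (l, j)) * (S $$ (j, ?b) / S $$ (j, j))"
      unfolding G_def sum_distrib_right by (simp add: sum_subtractf algebra_simps)
    also have "\<dots> = (if a = b then 1 else 0)"
      using RSe[OF ab'(1,2)] RSe[OF ab'(1), of j] ab' ijk
        strict_mono_eq[OF strict_mono_insert_index] by auto
    finally show "(mat_delete R j j * G') $$ (a, b) = 1\<^sub>m (n - 1) $$ (a, b)" using ab by simp
  qed (use R' G' in auto)
  have idx: "insert_index j i = i" "insert_index j (k - 1) = k" "i < n - 1" "k - 1 < n - 1"
    using ijk by (auto simp: insert_index_def)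
  from tn_real_inverse_checkerboard[OF R' tn_real_mat_delete[OF tn] G' inv idx(3,4)]
  have "0 \<le> (-1) ^ (i + (k - 1)) * G i k"
    by (simp only: G'_def index_mat idx prod.case)
  moreover have "(-1::real) ^ (i + k) = - ((-1) ^ (i + (k - 1)))"
    using ijk by (metis Suc_pred' add_Suc_right gr_implies_not0 mult_minus1 neq0_conv power_Suc)
  ultimately have "(-1) ^ (i + k) * G i k \<le> 0" by simp
  then have "(-1) ^ (i + k) * G i k * S $$ (j, j) \<le> 0" using pos by (simp add: mult_le_0_iff)
  moreover have "G i k * S $$ (j, j) = S $$ (i, k) * S $$ (j, j) - S $$ (i, j) * S $$ (j, k)"
    using pos by (simp add: G_def field_simps)
  ultimately have "(-1) ^ (i + k) * (S $$ (i, k) * S $$ (j, j) - S $$ (i, j) * S $$ (j, k)) \<le> 0"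
    by (simp add: mult.assoc)
  moreover have "(-1::real) ^ (i + j) * (-1) ^ (j + k) = (-1) ^ (i + k)"
    by (cases "even i"; cases "even j"; cases "even k") simp_all
  moreover have "((-1) ^ (i + j) * S $$ (i, j)) * ((-1) ^ (j + k) * S $$ (j, k)) 
      = ((-1) ^ (i + j) * (-1) ^ (j + k)) * (S $$ (i, j) * S $$ (j, k))"
    by (simp only: mult_ac)
  ultimately show ?thesis by (simp only: right_diff_distrib mult.assoc diff_le_0_iff_le)
qed

section \<open>Row sums of the inverse of a totally nonnegative symmetric matrix\<close>

text \<open>The estimate for \<open>c\<close>, which is \<open>l\<close> times the entrywise
  absolute value of \<open>S\<close>, with \<open>q\<close> close to \<open>l / r\<close>, gives row
  sums at most \<open>r / l\<close>; division by \<open>l\<close> produces the square.\<close>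

lemma tn_real_inverse_row_sum:
  assumes R: "R \<in> carrier_mat n n" and tn: "tn_real R"
    and S: "S \<in> carrier_mat n n" and RS: "R * S = 1\<^sub>m n"
    and sym: "\<And>i j. i < n \<Longrightarrow> j < n \<Longrightarrow> R $$ (i, j) = R $$ (j, i)"
    and l: "0 < l" and low: "\<And>x. l * (\<Sum>i<n. x i ^ 2) \<le> (\<Sum>i<n. \<Sum>j<n. x i * R $$ (i, j) * x j)"
    and rows: "\<And>i. i < n \<Longrightarrow> (\<Sum>j<n. \<bar>R $$ (i, j)\<bar>) \<le> r" and m: "m < n"
  shows "(\<Sum>k<n. \<bar>S $$ (m, k)\<bar>) \<le> r / l ^ 2"
proof -
  have RSe: "(\<Sum>k<n. R $$ (a, k) * S $$ (k, b)) = (if a = b then 1 else 0)" if "a < n" "b < n" for a b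
  proof -
    have "(R * S) $$ (a, b) = (\<Sum>k<n. R $$ (a, k) * S $$ (k, b))"
      using R S that by (simp add: scalar_prod_def atLeast0LessThan)
    then show ?thesis using RS that by simp
  qed
  have RT: "R\<^sup>T = R" using R by (intro eq_matI) (auto simp: sym)
  have "S\<^sup>T * R = 1\<^sub>m n" using transpose_mult[OF R S] RS RT by simp
  then have "S\<^sup>T * R * S = S" using S by simp
  then have ST: "S\<^sup>T = S" using R S RS by simp
  have symS: "S $$ (i, j) = S $$ (j, i)" if "i < n" "j < n" for i j
    using ST S that by (metis carrier_matD index_transpose_mat(1))
  have diagR: "R $$ (j, j) \<le> r" if "j < n" for j
  proof -
    have "\<bar>R $$ (j, j)\<bar> \<le> (\<Sum>k<n. \<bar>R $$ (j, k)\<bar>)"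
      using that by (intro member_le_sum) auto
    then show ?thesis using rows[OF that] by linarith
  qed
  have quad: "l * (\<Sum>i<n. x i ^ 2) \<le> (\<Sum>i<n. x i * y i)"
    if "\<And>i. i < n \<Longrightarrow> y i = (\<Sum>j<n. R $$ (i, j) * x j)" for x y
    using low[of x] that by (simp add: sum_distrib_left mult.assoc)
  have lr: "l \<le> r"
  proof -
    let ?e = "\<lambda>i. if i = m then 1 else 0 :: real"
    have "l * (\<Sum>i<n. ?e i ^ 2) \<le> (\<Sum>i<n. ?e i * R $$ (i, m))"
      using m by (intro quad) (simp add: if_distrib cong: if_cong)
    moreover have "(\<Sum>i<n. ?e i ^ 2) = (\<Sum>i<n. ?e i)" by (rule sum.cong) auto
    moreover have "(\<Sum>i<n. ?e i * R $$ (i, m)) = (\<Sum>i<n. if i = m then R $$ (m, m) else 0)"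
      by (rule sum.cong) auto
    ultimately show ?thesis using m diagR[OF m] by simp
  qed
  then have r: "r > 0" using l by simp
  have diagS: "1 / r \<le> S $$ (j, j)" if j: "j < n" for j
  proof -
    let ?e = "\<lambda>i. if i = j then 1 else 0 :: real"
    \<comment> \<open>The form of \<open>R\<close> at column \<open>j\<close> of \<open>S\<close>
      minus the unit vector over \<open>r\<close> is
      \<open>S $$ (j, j) - 2 / r + R $$ (j, j) / r ^ 2\<close>. It is nonnegative, and
      \<open>R $$ (j, j) \<le> r\<close> then gives the bound.\<close>
    define x where "x i = S $$ (i, j) - ?e i / r" for i
    have "0 \<le> l * (\<Sum>i<n. x i ^ 2)" using l by (simp add: sum_nonneg)
    also have "\<dots> \<le> (\<Sum>i<n. x i * (?e i - R $$ (i, j) / r))"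
    proof (rule quad)
      fix i assume i: "i < n"
      have "(\<Sum>k<n. R $$ (i, k) * x k) = (\<Sum>k<n. R $$ (i, k) * S $$ (k, j)) - (\<Sum>k<n. if k = j then R $$ (i, j) / r else 0)"
        unfolding x_def sum_subtractf[symmetric] by (rule sum.cong) (auto simp: algebra_simps)
      then show "?e i - R $$ (i, j) / r = (\<Sum>k<n. R $$ (i, k) * x k)" using RSe[OF i j] j by simp
    qed
    also have "\<dots> = (\<Sum>i<n. (if i = j then S $$ (j, j) - 1 / r + R $$ (j, j) / r ^ 2 else 0) - R $$ (j, i) * S $$ (i, j) / r)"
    proof (rule sum.cong)
      fix i assume "i \<in> {..<n}"
      then show "x i * (?e i - R $$ (i, j) / r)
          = (if i = j then S $$ (j, j) - 1 / r + R $$ (j, j) / r ^ 2 else 0) - R $$ (j, i) * S $$ (i, j) / r"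
        using sym[OF j, of i] by (cases "i = j") (simp_all add: x_def algebra_simps power2_eq_square)
    qed simp
    also have "\<dots> = S $$ (j, j) - 1 / r + R $$ (j, j) / r ^ 2 - 1 / r"
      using RSe[OF j j] j by (simp add: sum_subtractf flip: sum_divide_distrib)
    also have "\<dots> \<le> S $$ (j, j) - 1 / r + r / r ^ 2 - 1 / r"
      using diagR[OF j] by (intro diff_right_mono add_left_mono divide_right_mono) auto
    also have "\<dots> = S $$ (j, j) - 1 / r" using r by (simp add: power2_eq_square)
    finally show ?thesis by simp
  qed
  define c where "c i j = l * ((-1) ^ (i + j) * S $$ (i, j))" for i j
  have nonneg: "0 \<le> c i j" if "i < n" "j < n" for i j
    using tn_real_inverse_checkerboard[OF R tn S RS that] l by (simp add: c_def)
  have symc: "c i j = c j i" if "i < n" "j < n" for i j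
    using symS[OF that] by (simp add: c_def add.commute)
  have minor: "c i k * c j j \<le> c i j * c j k" if ijk: "i < j" "j < k" "k < n" for i j k
  proof -
    have "0 < 1 / r" using r by simp
    then have "0 < S $$ (j, j)" using diagS[of j] ijk by linarith
    from tn_real_inverse_minor[OF R tn S RS ijk this]
    have "l * l * ((-1) ^ (i + k) * S $$ (i, k) * S $$ (j, j))
        \<le> l * l * ((-1) ^ (i + j) * S $$ (i, j) * ((-1) ^ (j + k) * S $$ (j, k)))"
      using l by (intro mult_left_mono) auto
    then show ?thesis by (simp add: c_def mult_ac)
  qed
  have form: "(\<Sum>i<n. \<Sum>j<n. v i * c i j * v j) \<le> (\<Sum>i<n. v i ^ 2)" for v
  proof -
    define u where "u i = (-1) ^ i * v i" for i
    define x where "x i = (\<Sum>j<n. S $$ (i, j) * u j)" for i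
    have Rx: "u i = (\<Sum>k<n. R $$ (i, k) * x k)" if i: "i < n" for i
    proof -
      have "(\<Sum>k<n. R $$ (i, k) * x k) = (\<Sum>k<n. \<Sum>j<n. R $$ (i, k) * S $$ (k, j) * u j)"
        by (simp add: x_def sum_distrib_left mult.assoc)
      also have "\<dots> = (\<Sum>j<n. (\<Sum>k<n. R $$ (i, k) * S $$ (k, j)) * u j)"
        by (subst sum.swap) (simp add: sum_distrib_right)
      also have "\<dots> = (\<Sum>j<n. if j = i then u i else 0)" by (rule sum.cong) (auto simp: RSe i)
      finally show ?thesis using i by simp
    qed
    define \<beta> where "\<beta> = (\<Sum>i<n. x i * u i)"
    \<comment> \<open>Here \<open>x\<close> is \<open>S\<close> applied to \<open>u\<close>, so
      \<beta> is the form of \<open>S\<close> at \<open>u\<close> and of \<open>R\<close> at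
      \<open>x\<close>. Expanding this square and using \<open>low\<close> at \<open>x\<close>
      bounds the form of \<open>S\<close> without diagonalising it.\<close>
    have "0 \<le> (\<Sum>i<n. (l * x i - u i) ^ 2)" by (simp add: sum_nonneg)
    also have "\<dots> = l * (l * (\<Sum>i<n. x i ^ 2)) - 2 * l * \<beta> + (\<Sum>i<n. u i ^ 2)"
      unfolding \<beta>_def sum_distrib_left sum_subtractf[symmetric] sum.distrib[symmetric]
      by (rule sum.cong) (auto simp: power2_diff power_mult_distrib power2_eq_square algebra_simps)
    also have "l * (l * (\<Sum>i<n. x i ^ 2)) \<le> l * \<beta>"
      using quad[of u x, OF Rx] l by (intro mult_left_mono) (auto simp: \<beta>_def)
    finally have "l * \<beta> \<le> (\<Sum>i<n. u i ^ 2)" by (simp add: mult.commute)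
    moreover have "(\<Sum>i<n. u i ^ 2) = (\<Sum>i<n. v i ^ 2)"
    proof (rule sum.cong)
      show "u i ^ 2 = v i ^ 2" for i by (cases "even i") (simp_all add: u_def)
    qed simp
    moreover have "(\<Sum>i<n. \<Sum>j<n. v i * c i j * v j) = l * \<beta>"
      unfolding \<beta>_def x_def sum_distrib_left sum_distrib_right
      by (intro sum.cong) (auto simp: c_def u_def power_add)
    ultimately show ?thesis by simp
  qed
  define M where "M = (\<Sum>k<n. c m k)"
  \<comment> \<open>\<open>l / r\<close> may be \<open>1\<close>, where the weights of the row sum estimate are undefined.\<close>
  have "t * M \<le> r / l" if t: "0 < t" "t < 1" for t
  proof -
    have "M \<le> 1 / (t * (l / r))" unfolding M_def
    proof (rule row_sum_le_inverse[OF m _ _ nonneg symc _ form minor])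
      show "0 < t * (l / r)" using t l r by simp
      have "t * (l / r) \<le> t * 1" using t lr r by (intro mult_left_mono) auto
      then show "t * (l / r) < 1" using t by simp
      fix j assume "j < n"
      have "t * (l / r) \<le> 1 * (l / r)" using t l r by (intro mult_right_mono) auto
      also have "\<dots> = l * (1 / r)" by simp
      also have "\<dots> \<le> l * S $$ (j, j)" using diagS[OF \<open>j < n\<close>] l by (intro mult_left_mono) auto
      finally show "t * (l / r) \<le> c j j" by (simp add: c_def)
    qed auto
    then have "t * M \<le> t * (1 / (t * (l / r)))" using t by (intro mult_left_mono) auto
    then show ?thesis using t by simp
  qed
  then have M: "M \<le> r / l" by (rule field_le_mult_one_interval)
  have "M = l * (\<Sum>k<n. \<bar>S $$ (m, k)\<bar>)"
    unfolding M_def sum_distrib_left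
  proof (rule sum.cong)
    fix k assume "k \<in> {..<n}"
    then have "\<bar>c m k\<bar> = c m k" using nonneg m by simp
    then show "c m k = l * \<bar>S $$ (m, k)\<bar>" using l by (simp add: c_def abs_mult)
  qed simp
  then show ?thesis using M l by (simp add: field_simps power2_eq_square)
qed

section \<open>Passage from complex to real matrices and conclusion\<close>

lemma submatrix_map_mat:
  assumes "I \<subseteq> {0..<dim_row A}" "J \<subseteq> {0..<dim_col A}"
  shows "submatrix (map_mat f A) I J = map_mat f (submatrix A I J)"
proof -
  have "{i. i < dim_row A \<and> i \<in> I} = I" "{j. j < dim_col A \<and> j \<in> J} = J" using assms by auto
  moreover have "pick I i < dim_row A" if "i < card I" for i using pick_in_set[of i I] that assms by auto
  moreover have "pick J i < dim_col A" if "i < card J" for i using pick_in_set[of i J] that assms by auto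
  ultimately show ?thesis by (intro eq_matI) (auto simp: submatrix_def)
qed

lemma totally_nonneg_entry:
  assumes "totally_nonneg A" "i < dim_row A" "j < dim_col A"
  shows "complex_nonneg (A $$ (i, j))"
proof -
  have p: "pick {k} 0 = k" for k :: nat by (simp add: Least_equality)
  have "{a. a < dim_row A \<and> a \<in> {i}} = {i}" "{a. a < dim_col A \<and> a \<in> {j}} = {j}" using assms by auto
  then have "submatrix A {i} {j} = mat 1 1 (\<lambda>_. A $$ (i, j))"
    by (intro eq_matI) (auto simp: submatrix_def p simp del: pick.simps)
  then have "det (submatrix A {i} {j}) = A $$ (i, j)" by (simp add: det_single)
  moreover have "{i} \<subseteq> {0..<dim_row A}" "{j} \<subseteq> {0..<dim_col A}" "card {i} = card {j}" "{i} \<noteq> {}"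
    using assms by auto
  ultimately show ?thesis using assms(1) unfolding totally_nonneg_def by metis
qed

lemma totally_pos_det:
  assumes "A \<in> carrier_mat n n" "0 < n" "totally_pos A"
  shows "det A \<noteq> 0"
proof -
  have "dim_row A = n" "dim_col A = n" using assms by auto
  then have "complex_pos (det (submatrix A {0..<n} {0..<n}))"
    using assms(2,3) unfolding totally_pos_def by simp
  then show ?thesis using submatrix_full[of A] assms(1) by (auto simp: complex_pos_def)
qed

theorem theorem2:
  fixes A :: "complex mat" and n :: nat and lmin :: real
  assumes "A \<in> carrier_mat n n"
    and "oscillatory A"
    and "hermitian A"
    and "eigenvalue A (complex_of_real lmin)"
    and "\<forall>\<mu>. eigenvalue A \<mu> \<longrightarrow> lmin \<le> Re \<mu>"
  shows "norm_inf (inv_mat A) \<le> norm_inf A / lmin ^ 2"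
proof -
  note A = assms(1)
  let ?c = "map_mat complex_of_real"
  have n: "n > 0" using eigenvalue_imp_nonzero_dim[OF A assms(4)] .
  have tnA: "totally_nonneg A" using assms(2) by (simp add: oscillatory_def)
  define R where "R = map_mat Re A"
  have R: "R \<in> carrier_mat n n" using A by (simp add: R_def)
  \<comment> \<open>The entries are minors of size 1, hence real.\<close>
  have AR: "A = ?c R"
    using totally_nonneg_entry[OF tnA] by (intro eq_matI) (auto simp: R_def complex_nonneg_def complex_eq_iff)
  have tn: "tn_real R" unfolding tn_real_def
  proof (intro allI impI, elim conjE)
    fix I J assume IJ: "I \<subseteq> {0..<dim_row R}" "J \<subseteq> {0..<dim_col R}" "card I = card J"
    show "0 \<le> det (submatrix R I J)"
    proof (cases "I = {}")
      case True
      then have "J = {}" using IJ by (metis card_0_eq card.empty finite_atLeastLessThan finite_subset)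
      then show ?thesis using True by (simp add: submatrix_def)
    next
      case False
      then have "complex_nonneg (det (submatrix A I J))"
        using tnA IJ unfolding totally_nonneg_def AR by simp
      moreover have "det (submatrix A I J) = complex_of_real (det (submatrix R I J))"
        unfolding AR submatrix_map_mat[OF IJ(1,2)] by simp
      ultimately show ?thesis by (simp add: complex_nonneg_def)
    qed
  qed
  have sym: "R $$ (i, j) = R $$ (j, i)" if "i < n" "j < n" for i j
  proof -
    have "dim_row A = n" using A by simp
    then have "A $$ (i, j) = cnj (A $$ (j, i))" using assms(3) that unfolding hermitian_def by blast
    then have "Re (A $$ (i, j)) = Re (A $$ (j, i))" by simp
    then show ?thesis using A that by (simp add: R_def)
  qed
  \<comment> \<open>The full minor of the totally positive power is nonzero, and it is a power of
    \<open>det A\<close>.\<close>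
  have "det A \<noteq> 0"
  proof -
    obtain k where "k \<ge> 1" and k: "totally_pos (A ^\<^sub>m k)" using assms(2) by (auto simp: oscillatory_def)
    have "det (A ^\<^sub>m k) \<noteq> 0" using totally_pos_det[OF _ n k] A by simp
    moreover have "det (A ^\<^sub>m j) = det A ^ j" for j
    proof (induction j)
      case (Suc j)
      have "det (A ^\<^sub>m Suc j) = det (A ^\<^sub>m j * A)" by simp
      also have "\<dots> = det (A ^\<^sub>m j) * det A" using A by (intro det_mult[of _ n]) auto
      finally show ?case using Suc by simp
    qed (use A in simp)
    ultimately show ?thesis using \<open>k \<ge> 1\<close> by (auto simp: zero_power)
  qed
  then have "det R \<noteq> 0" unfolding AR by simp
  then have detR: "det R > 0" using tn_real_det[OF R tn] by simp
  define S where "S = (1 / det R) \<cdot>\<^sub>m adj_mat R"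
  have S: "S \<in> carrier_mat n n" using adj_mat[OF R] by (simp add: S_def)
  have "R * S = (1 / det R) \<cdot>\<^sub>m (det R \<cdot>\<^sub>m 1\<^sub>m n)"
    using adj_mat[OF R] R by (simp add: S_def mult_smult_distrib)
  then have RS: "R * S = 1\<^sub>m n" using detR by (intro eq_matI) auto
  have SR: "S * R = 1\<^sub>m n" by (rule mat_mult_left_right_inverse[OF R S RS])
  have cS: "?c S \<in> carrier_mat n n" using S by simp
  have AS: "A * ?c S = 1\<^sub>m n" "?c S * A = 1\<^sub>m n"
    unfolding AR using R S RS SR
    by (simp_all add: of_real_hom.mat_hom_one flip: of_real_hom.mat_hom_mult[of _ n n _ n])
  \<comment> \<open>Uniqueness of the two-sided inverse identifies the matrix picked by
    \<open>SOME\<close>.\<close>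
  have inv: "inv_mat A = ?c S"
  proof -
    let ?P = "\<lambda>B. B \<in> carrier_mat n n \<and> A * B = 1\<^sub>m n \<and> B * A = 1\<^sub>m n"
    have "?P (inv_mat A)" using someI[of ?P "?c S"] AS cS A unfolding inv_mat_def by simp
    then have B: "inv_mat A \<in> carrier_mat n n" "A * inv_mat A = 1\<^sub>m n" by auto
    have "inv_mat A = ?c S * A * inv_mat A" using AS B by simp
    also have "\<dots> = ?c S * (A * inv_mat A)" by (rule assoc_mult_mat[OF cS A B(1)])
    finally show ?thesis using B cS by simp
  qed
  have "\<exists>\<mu> v. (\<exists>i<n. v i \<noteq> 0) \<and> (\<forall>i<n. (\<Sum>j<n. R $$ (i, j) * v j) = \<mu> * v i)
      \<and> (\<forall>x. \<mu> * (\<Sum>i<n. x i ^ 2) \<le> (\<Sum>i<n. \<Sum>j<n. x i * R $$ (i, j) * x j))"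
    by (rule symmetric_min_eigenvector[OF n sym])
  then obtain \<mu> v where "(\<exists>i<n. v i \<noteq> 0) \<and> (\<forall>i<n. (\<Sum>j<n. R $$ (i, j) * v j) = \<mu> * v i)
      \<and> (\<forall>x. \<mu> * (\<Sum>i<n. x i ^ 2) \<le> (\<Sum>i<n. \<Sum>j<n. x i * R $$ (i, j) * x j))"
    by (elim exE)
  then have v: "\<exists>i<n. v i \<noteq> 0" "\<And>i. i < n \<Longrightarrow> (\<Sum>j<n. R $$ (i, j) * v j) = \<mu> * v i"
    and ray: "\<And>x. \<mu> * (\<Sum>i<n. x i ^ 2) \<le> (\<Sum>i<n. \<Sum>j<n. x i * R $$ (i, j) * x j)"
    by simp_all
  \<comment> \<open>The real minimiser, read as a complex vector, is an eigenvector of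
    \<open>A\<close>, so the minimality of \<open>lmin\<close> applies to \<mu>.\<close>
  have "lmin \<le> \<mu>"
  proof -
    let ?v = "vec n (\<lambda>i. complex_of_real (v i))"
    have "A *\<^sub>v ?v = complex_of_real \<mu> \<cdot>\<^sub>v ?v"
    proof (rule eq_vecI)
      fix i assume "i < dim_vec (complex_of_real \<mu> \<cdot>\<^sub>v ?v)"
      then have i: "i < n" by simp
      then have "(A *\<^sub>v ?v) $ i = complex_of_real (\<Sum>j<n. R $$ (i, j) * v j)"
        using R unfolding AR by (simp add: scalar_prod_def atLeast0LessThan)
      then show "(A *\<^sub>v ?v) $ i = (complex_of_real \<mu> \<cdot>\<^sub>v ?v) $ i" using v(2)[OF i] i by simp
    qed (use A in simp)
    moreover have "?v \<noteq> 0\<^sub>v n" using v(1) by (metis index_vec index_zero_vec(1) of_real_eq_0_iff)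
    ultimately have "eigenvector A ?v (complex_of_real \<mu>)" using A by (simp add: eigenvector_def)
    then have "eigenvalue A (complex_of_real \<mu>)" unfolding eigenvalue_def by blast
    then have "lmin \<le> Re (complex_of_real \<mu>)" using assms(5) by blast
    then show ?thesis by simp
  qed
  have low: "lmin * (\<Sum>i<n. x i ^ 2) \<le> (\<Sum>i<n. \<Sum>j<n. x i * R $$ (i, j) * x j)" for x
    using ray[of x] mult_right_mono[OF \<open>lmin \<le> \<mu>\<close>, of "\<Sum>i<n. x i ^ 2"] by (simp add: sum_nonneg)
  \<comment> \<open>If \<open>lmin\<close> were at most 0, subtracting it on the diagonal could not
    lower the positive determinant of \<open>R\<close>, yet the result is singular because
    \<open>lmin\<close> is an eigenvalue.\<close>
  have lmin: "lmin > 0"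
  proof (rule ccontr)
    assume "\<not> lmin > 0"
    then have "det R \<le> det (mat n n (\<lambda>(i, j). R $$ (i, j) + (if i = j then - lmin else 0)))"
      by (intro det_add_diag_ge[OF R tn]) simp
    moreover have "char_matrix A (complex_of_real lmin)
        = ?c (mat n n (\<lambda>(i, j). R $$ (i, j) + (if i = j then - lmin else 0)))"
      using R unfolding AR by (intro eq_matI) (auto simp: char_matrix_def)
    then have "det (mat n n (\<lambda>(i, j). R $$ (i, j) + (if i = j then - lmin else 0))) = 0"
      using assms(4) eigenvalue_det[OF A] by simp
    ultimately show False using detR by simp
  qed
  have rows: "(\<Sum>j<n. \<bar>R $$ (i, j)\<bar>) \<le> norm_inf A" if i: "i < n" for i
  proof -
    have "(\<Sum>j<n. \<bar>R $$ (i, j)\<bar>) = (\<Sum>j<dim_col A. cmod (A $$ (i, j)))"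
      using R i unfolding AR by simp
    then show ?thesis unfolding norm_inf_def using A i by (intro Max_ge) auto
  qed
  have "norm_inf (?c S) = Max ((\<lambda>i. \<Sum>j<n. cmod (?c S $$ (i, j))) ` {..<n})"
    unfolding norm_inf_def setcompr_eq_image using S by (simp add: lessThan_def)
  also have "\<dots> \<le> norm_inf A / lmin ^ 2"
  proof (rule Max.boundedI)
    fix a assume "a \<in> (\<lambda>i. \<Sum>j<n. cmod (?c S $$ (i, j))) ` {..<n}"
    then obtain i where i: "i < n" and a: "a = (\<Sum>j<n. cmod (?c S $$ (i, j)))" by auto
    have "a = (\<Sum>j<n. \<bar>S $$ (i, j)\<bar>)" unfolding a using S i by simp
    also have "\<dots> \<le> norm_inf A / lmin ^ 2"
      by (rule tn_real_inverse_row_sum[OF R tn S RS sym lmin low rows i])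
    finally show "a \<le> norm_inf A / lmin ^ 2" .
  qed (use n in auto)
  finally show ?thesis unfolding inv .
qed

end
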